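(* Let $\mathbb{K}$ be $\mathbb{R}$ or $\mathbb{C}$ with its usual topology $\tau$, and let $\omega(\tau)$ be the usual fuzzy topology on $\mathbb{K}$, i.e. the set of all lower semi-continuous functions from $(\mathbb{K},\tau)$ into $[0,1]$. Let $(E,E')$ be a dual pair of vector spaces over $\mathbb{K}$, let $\sigma(E,E')$ be the usual (non-fuzzy) weak topology on $E$, and let $\omega(\sigma(E,E'))$ be the set of all lower semi-continuous functions from $(E,\sigma(E,E'))$ into $[0,1]$. Then $$\sigma^{\omega(\tau)}_f(E,E')=\omega(\sigma(E,E')),$$ where $\sigma^{\omega(\tau)}_f(E,E')$ is the weak fuzzy topology on $E$ generated by the functionals $x\mapsto\langle x,x'\rangle$, $x'\in E'$, with $\mathbb{K}$ carrying the fuzzy topology $\omega(\tau)$.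
   Context: Let $I=[0,1]$. A fuzzy set in a set $X$ is a function $X\to I$; order, $\wedge$ and suprema are pointwise. A fuzzy topology on $X$ is a set $\varphi\subseteq I^X$ that contains all constant functions and is closed under binary $\wedge$ and arbitrary suprema; its members are the open fuzzy sets. For $f:X\to Y$ and a fuzzy set $\eta$ in $Y$, $f^{-1}(\eta)=\eta\circ f$; $f$ is fuzzy continuous if $f^{-1}(\eta)$ is open for every open $\eta$. Dual pair: $(E,E')$ is a dual pair if $E,E'$ are vector spaces over $\mathbb{K}$ together with a bilinear form $\langle x,x'\rangle$ on $E\times E'$ such that for each $x\ne0$ in $E$ there is $x'\in E'$ with $\langle x,x'\rangle\ne0$, and for each $x'\neq 0$ in $E'$ there is $x\in E$ with $\langle x,x'\rangle\ne0$. Each $x'\in E'$ is viewed as the linear functional $x'(x)=\langle x,x'\rangle$ on $E$. For a fuzzy topology $\Gamma$ on $\mathbb{K}$, the weak fuzzy topology $\sigma^\Gamma_f(E,E')$ is the coarsest fuzzy topology on $E$ making every $x':E\to(\mathbb{K},\Gamma)$, $x'\in E'$, fuzzy continuous; i.e. the fuzzy topology generated by the fuzzy sets $x'^{-1}(\mu)=\mu\circ x'$, $x'\in E'$, $\mu\in\Gamma$. The usual weak topology $\sigma(E,E')$ is the coarsest topology on $E$ making every $x'\in E'$ continuous into $\mathbb{K}$ with its usual topology. *)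

theory Defs
  imports "HOL-Analysis.Analysis"
begin

definition fuzzy_sets :: "('a \<Rightarrow> real) set" where
  "fuzzy_sets = {f. \<forall>x. f x \<in> {0..1}}"

text \<open>The supremum of the empty family of fuzzy sets is the constant 0, which is open because
  constants are; \<^term>\<open>Sup ({} :: real set)\<close> is unspecified, so only nonempty
  families are mentioned.\<close>

definition fuzzy_topology :: "('a \<Rightarrow> real) set \<Rightarrow> bool" where
  "fuzzy_topology \<phi> \<longleftrightarrow>
     \<phi> \<subseteq> fuzzy_sets \<and>
     (\<forall>c\<in>{0..1}. (\<lambda>_. c) \<in> \<phi>) \<and>
     (\<forall>f\<in>\<phi>. \<forall>g\<in>\<phi>. (\<lambda>x. min (f x) (g x)) \<in> \<phi>) \<and>
     (\<forall>A. A \<subseteq> \<phi> \<and> A \<noteq> {} \<longrightarrow> (\<lambda>x. SUP f\<in>A. f x) \<in> \<phi>)"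

definition fuzzy_continuous ::
  "('a \<Rightarrow> real) set \<Rightarrow> ('b \<Rightarrow> real) set \<Rightarrow> ('a \<Rightarrow> 'b) \<Rightarrow> bool" where
  "fuzzy_continuous \<phi> \<psi> f \<longleftrightarrow> (\<forall>\<eta>\<in>\<psi>. \<eta> \<circ> f \<in> \<phi>)"

definition fuzzy_topology_generated_by :: "('a \<Rightarrow> real) set \<Rightarrow> ('a \<Rightarrow> real) set" where
  "fuzzy_topology_generated_by S = \<Inter>{\<phi>. fuzzy_topology \<phi> \<and> S \<subseteq> \<phi>}"

definition lsc_fuzzy_sets :: "'a topology \<Rightarrow> ('a \<Rightarrow> real) set" where
  "lsc_fuzzy_sets T = {f \<in> fuzzy_sets. \<forall>a. openin T {x \<in> topspace T. a < f x}}"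

locale dual_pair =
  E: vector_space scaleE + E': vector_space scaleE'
  for scaleE :: "'k::field \<Rightarrow> 'a::ab_group_add \<Rightarrow> 'a"
    and scaleE' :: "'k \<Rightarrow> 'b::ab_group_add \<Rightarrow> 'b" +
  fixes pairing :: "'a \<Rightarrow> 'b \<Rightarrow> 'k"
  assumes linear_left: "Vector_Spaces.linear scaleE (*) (\<lambda>x. pairing x x')"
    and linear_right: "Vector_Spaces.linear scaleE' (*) (\<lambda>x'. pairing x x')"
    and separating_left: "x \<noteq> 0 \<Longrightarrow> \<exists>x'. pairing x x' \<noteq> 0"
    and separating_right: "x' \<noteq> 0 \<Longrightarrow> \<exists>x. pairing x x' \<noteq> 0"

definition weak_topology :: "('a \<Rightarrow> 'b \<Rightarrow> 'k::topological_space) \<Rightarrow> 'a topology" where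
  "weak_topology pairing =
     topology_generated_by {(\<lambda>x. pairing x x') -` U | x' U. open U}"

definition weak_fuzzy_topology ::
  "('k \<Rightarrow> real) set \<Rightarrow> ('a \<Rightarrow> 'b \<Rightarrow> 'k) \<Rightarrow> ('a \<Rightarrow> real) set" where
  "weak_fuzzy_topology \<Gamma> pairing =
     fuzzy_topology_generated_by {\<mu> \<circ> (\<lambda>x. pairing x x') | x' \<mu>. \<mu> \<in> \<Gamma>}"

lemma fuzzy_topology_fuzzy_sets: "fuzzy_topology fuzzy_sets"
proof -
  have "(\<lambda>x. SUP f\<in>A. f x) \<in> fuzzy_sets"
    if A: "A \<subseteq> fuzzy_sets" "A \<noteq> {}" for A :: "('a \<Rightarrow> real) set"
  proof -
    have "0 \<le> (SUP f\<in>A. f x)" "(SUP f\<in>A. f x) \<le> 1" for x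
    proof -
      have b: "0 \<le> f x" "f x \<le> 1" if "f \<in> A" for f
        using A(1) that by (auto simp: fuzzy_sets_def)
      obtain g where g: "g \<in> A"
        using A(2) by blast
      have "bdd_above ((\<lambda>f. f x) ` A)"
        using b(2) by (auto intro!: bdd_aboveI[of _ 1])
      then show "0 \<le> (SUP f\<in>A. f x)"
        using b(1)[OF g] g by (intro cSUP_upper2)
      show "(SUP f\<in>A. f x) \<le> 1"
        using A(2) b(2) by (intro cSUP_least)
    qed
    then show ?thesis
      by (simp add: fuzzy_sets_def)
  qed
  then show ?thesis
    by (auto simp: fuzzy_topology_def) (auto simp: fuzzy_sets_def min_def)
qed

lemma fuzzy_topology_generated_by:
  assumes "S \<subseteq> fuzzy_sets"
  shows "fuzzy_topology (fuzzy_topology_generated_by S)"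
proof -
  have "fuzzy_topology_generated_by S \<subseteq> fuzzy_sets"
    unfolding fuzzy_topology_generated_by_def using assms fuzzy_topology_fuzzy_sets by blast
  moreover have "(\<lambda>x. SUP f\<in>A. f x) \<in> fuzzy_topology_generated_by S"
    if A: "A \<subseteq> fuzzy_topology_generated_by S" "A \<noteq> {}" for A
    unfolding fuzzy_topology_generated_by_def
  proof (rule InterI)
    fix \<phi> assume \<phi>: "\<phi> \<in> {\<phi>. fuzzy_topology \<phi> \<and> S \<subseteq> \<phi>}"
    then have "A \<subseteq> \<phi>"
      using A by (auto simp: fuzzy_topology_generated_by_def)
    then show "(\<lambda>x. SUP f\<in>A. f x) \<in> \<phi>"
      using \<phi> A(2) by (simp add: fuzzy_topology_def)
  qed
  moreover have "(\<lambda>_. c) \<in> fuzzy_topology_generated_by S" if "c \<in> {0..1}" for c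
    using that by (simp add: fuzzy_topology_generated_by_def fuzzy_topology_def)
  moreover have "(\<lambda>x. min (f x) (g x)) \<in> fuzzy_topology_generated_by S"
    if "f \<in> fuzzy_topology_generated_by S" "g \<in> fuzzy_topology_generated_by S" for f g
    using that by (simp add: fuzzy_topology_generated_by_def fuzzy_topology_def)
  ultimately show ?thesis
    by (simp add: fuzzy_topology_def)
qed

lemma fuzzy_topology_weak_fuzzy_topology:
  assumes "\<Gamma> \<subseteq> fuzzy_sets"
  shows "fuzzy_topology (weak_fuzzy_topology \<Gamma> pairing)"
  unfolding weak_fuzzy_topology_def
  using assms by (intro fuzzy_topology_generated_by) (auto simp: fuzzy_sets_def)

lemma fuzzy_continuous_weak_fuzzy_topology:
  "fuzzy_continuous (weak_fuzzy_topology \<Gamma> pairing) \<Gamma> (\<lambda>x. pairing x x')"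
  unfolding fuzzy_continuous_def weak_fuzzy_topology_def fuzzy_topology_generated_by_def
  by blast

lemma weak_fuzzy_topology_coarsest:
  assumes "fuzzy_topology \<phi>" and "\<And>x'. fuzzy_continuous \<phi> \<Gamma> (\<lambda>x. pairing x x')"
  shows "weak_fuzzy_topology \<Gamma> pairing \<subseteq> \<phi>"
proof -
  have "{\<mu> \<circ> (\<lambda>x. pairing x x') | x' \<mu>. \<mu> \<in> \<Gamma>} \<subseteq> \<phi>"
    using assms(2) by (auto simp: fuzzy_continuous_def)
  then show ?thesis
    using assms(1) unfolding weak_fuzzy_topology_def fuzzy_topology_generated_by_def by blast
qed

lemma topspace_weak_topology [simp]: "topspace (weak_topology pairing) = UNIV"
proof -
  have "UNIV = (\<lambda>x. pairing x undefined) -` UNIV"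
    by simp
  then show ?thesis
    unfolding weak_topology_def topology_generated_by_topspace using open_UNIV by blast
qed

lemma continuous_map_weak_topology:
  "continuous_map (weak_topology pairing) euclidean (\<lambda>x. pairing x x')"
proof -
  have "openin (weak_topology pairing) ((\<lambda>x. pairing x x') -` U)" if "open U" for U
    unfolding weak_topology_def using that by (intro topology_generated_by_Basis) blast
  then show ?thesis
    by (simp add: continuous_map_def vimage_def)
qed

lemma weak_topology_coarsest:
  assumes "topspace T = UNIV"
    and "\<And>x'. continuous_map T euclidean (\<lambda>x. pairing x x')"
    and "openin (weak_topology pairing) U"
  shows "openin T U"
proof (rule generate_topology_on_coarsest)
  show "istopology (openin T)"
    by simp
  show "generate_topology_on {(\<lambda>x. pairing x x') -` U | x' U. open U} U"
    using assms(3) by (simp add: weak_topology_def openin_topology_generated_by_iff)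
  show "openin T s" if "s \<in> {(\<lambda>x. pairing x x') -` U | x' U. open U}" for s
    using that assms(1,2) by (auto simp: continuous_map_def vimage_def)
qed

end

theory Submission
  imports Defs
begin

text \<open>A lower semicontinuous \<open>f\<close> into \<open>[0,1]\<close> is the supremum over \<open>c \<in> [0,1]\<close> of the meets
  of the constant \<open>c\<close> with the indicator of the open set \<open>{x. c < f x}\<close>. A fuzzy topology that
  contains the indicators of a subbase contains the indicators of all open sets, because finite
  intersections and unions correspond to minima and suprema of indicators. So only the indicators
  of the sets \<open>{x. \<langle>x, x'\<rangle> \<in> U}\<close> matter, and those are the pullbacks of the indicators of the open
  sets \<open>U\<close> of scalars.\<close>

lemma
  assumes "fuzzy_topology \<phi>"
  shows fuzzy_topology_const: "c \<in> {0..1} \<Longrightarrow> (\<lambda>_. c) \<in> \<phi>"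
    and fuzzy_topology_min: "f \<in> \<phi> \<Longrightarrow> g \<in> \<phi> \<Longrightarrow> (\<lambda>x. min (f x) (g x)) \<in> \<phi>"
    and fuzzy_topology_SUP: "A \<subseteq> \<phi> \<Longrightarrow> A \<noteq> {} \<Longrightarrow> (\<lambda>x. SUP f\<in>A. f x) \<in> \<phi>"
  using assms by (simp_all add: fuzzy_topology_def)

lemma bdd_above_fuzzy_sets: "A \<subseteq> fuzzy_sets \<Longrightarrow> bdd_above ((\<lambda>f. f x) ` A)"
  by (rule bdd_aboveI[of _ 1]) (auto simp: fuzzy_sets_def)

text \<open>Passing to strict superlevel sets turns a minimum into an intersection and a supremum
  into a union, so the axioms of a topology give those of a fuzzy topology.\<close>

lemma fuzzy_topology_lsc_fuzzy_sets: "fuzzy_topology (lsc_fuzzy_sets T)"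
proof -
  have "(\<lambda>_. c) \<in> lsc_fuzzy_sets T" if "c \<in> {0..1}" for c
  proof -
    have "openin T {x \<in> topspace T. a < c}" for a
      by (cases "a < c") auto
    then show ?thesis
      using that by (simp add: lsc_fuzzy_sets_def fuzzy_sets_def)
  qed
  moreover have "(\<lambda>x. min (f x) (g x)) \<in> lsc_fuzzy_sets T"
    if f: "f \<in> lsc_fuzzy_sets T" and g: "g \<in> lsc_fuzzy_sets T" for f g
  proof -
    have "{x \<in> topspace T. a < min (f x) (g x)} =
        {x \<in> topspace T. a < f x} \<inter> {x \<in> topspace T. a < g x}" for a
      by auto
    moreover have "(\<lambda>x. min (f x) (g x)) \<in> fuzzy_sets"
      using f g by (auto simp: lsc_fuzzy_sets_def fuzzy_sets_def min_def)
    ultimately show ?thesis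
      using f g by (simp add: lsc_fuzzy_sets_def openin_Int)
  qed
  moreover have "(\<lambda>x. SUP f\<in>A. f x) \<in> lsc_fuzzy_sets T"
    if A: "A \<subseteq> lsc_fuzzy_sets T" "A \<noteq> {}" for A
  proof -
    have sub: "A \<subseteq> fuzzy_sets"
      using A(1) by (auto simp: lsc_fuzzy_sets_def)
    \<comment> \<open>A supremum exceeds \<open>a\<close> exactly when some member does. On the
      reals this needs a nonempty family that is bounded above; the bound here is 1.\<close>
    have "{x \<in> topspace T. a < (SUP f\<in>A. f x)} = (\<Union>f\<in>A. {x \<in> topspace T. a < f x})" for a
      using less_cSUP_iff[OF A(2) bdd_above_fuzzy_sets[OF sub]] by auto
    moreover have "openin T (\<Union>f\<in>A. {x \<in> topspace T. a < f x})" for a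
      using A(1) by (intro openin_Union) (auto simp: lsc_fuzzy_sets_def)
    moreover have "(\<lambda>x. SUP f\<in>A. f x) \<in> fuzzy_sets"
      using fuzzy_topology_fuzzy_sets sub A(2) by (rule fuzzy_topology_SUP)
    ultimately show ?thesis
      by (simp add: lsc_fuzzy_sets_def)
  qed
  ultimately show ?thesis
    by (auto simp: fuzzy_topology_def lsc_fuzzy_sets_def)
qed

text \<open>The strict superlevel sets of \<open>\<eta> \<circ> f\<close> are the preimages under
  \<open>f\<close> of those of \<open>\<eta>\<close>.\<close>

lemma fuzzy_continuous_lsc_fuzzy_sets:
  assumes f: "continuous_map S T f" and S: "topspace S = UNIV"
  shows "fuzzy_continuous (lsc_fuzzy_sets S) (lsc_fuzzy_sets T) f"
  unfolding fuzzy_continuous_def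
proof
  fix \<eta> assume \<eta>: "\<eta> \<in> lsc_fuzzy_sets T"
  have "openin S {x \<in> topspace S. a < \<eta> (f x)}" for a
  proof -
    have "openin S {x \<in> topspace S. f x \<in> {y \<in> topspace T. a < \<eta> y}}"
      using f \<eta> by (intro openin_continuous_map_preimage) (auto simp: lsc_fuzzy_sets_def)
    moreover have "f x \<in> topspace T" for x
      using f S by (auto simp: continuous_map_def)
    ultimately show ?thesis
      by simp
  qed
  then show "\<eta> \<circ> f \<in> lsc_fuzzy_sets S"
    using \<eta> by (simp add: lsc_fuzzy_sets_def fuzzy_sets_def)
qed

lemma indicator_in_lsc_fuzzy_sets:
  assumes "openin T U"
  shows "indicat_real U \<in> lsc_fuzzy_sets T"
proof -
  have "{x \<in> topspace T. a < indicat_real U x} =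
      (if a < 0 then topspace T else if a < 1 then U else {})" for a
    using openin_subset[OF assms] by (auto simp: indicator_def)
  then show ?thesis
    using assms by (simp add: lsc_fuzzy_sets_def fuzzy_sets_def)
qed

lemma indicator_in_fuzzy_topology:
  assumes \<phi>: "fuzzy_topology \<phi>" and B: "\<And>U. U \<in> B \<Longrightarrow> indicat_real U \<in> \<phi>"
    and U: "openin (topology_generated_by B) U"
  shows "indicat_real U \<in> \<phi>"
proof -
  have "generate_topology_on B U"
    using U by (simp add: openin_topology_generated_by_iff)
  then show ?thesis
  proof induction
    case Empty
    have "indicat_real {} = (\<lambda>_::'a. 0)"
      by auto
    then show ?case
      using \<phi> by (simp add: fuzzy_topology_def)
  next
    case (Int U V)
    have "indicat_real (U \<inter> V) = (\<lambda>x. min (indicat_real U x) (indicat_real V x))"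
      by (auto simp: indicator_def)
    then show ?case
      using \<phi> Int.IH by (simp add: fuzzy_topology_def)
  next
    case (UN K)
    \<comment> \<open>The empty union is treated apart: closure under suprema covers nonempty
      families only, and the constant 0 takes the place of the empty supremum.\<close>
    show ?case
    proof (cases "K = {}")
      case True
      have "indicat_real {} = (\<lambda>_::'a. 0)"
        by auto
      then show ?thesis
        using \<phi> True by (simp add: fuzzy_topology_def)
    next
      case False
      have "indicat_real (\<Union>K) x = (SUP k\<in>K. indicat_real k x)" for x
      proof (rule antisym)
        have bdd: "bdd_above ((\<lambda>k. indicat_real k x) ` K)"
          by (rule bdd_aboveI[of _ 1]) (auto simp: indicator_def)
        \<comment> \<open>If \<open>x\<close> is in the union, \<open>k\<close> is a member
          containing \<open>x\<close>; otherwise any \<open>k\<close> in \<open>K\<close> serves,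
          the left side being 0.\<close>
        obtain k where "k \<in> K" "indicat_real (\<Union>K) x \<le> indicat_real k x"
          using False by (cases "x \<in> \<Union>K") (auto simp: indicator_def)
        then show "indicat_real (\<Union>K) x \<le> (SUP k\<in>K. indicat_real k x)"
          by (rule cSUP_upper2[OF bdd])
        show "(SUP k\<in>K. indicat_real k x) \<le> indicat_real (\<Union>K) x"
          using False by (rule cSUP_least) (auto simp: indicator_def)
      qed
      then have "indicat_real (\<Union>K) = (\<lambda>x. SUP f\<in>indicat_real ` K. f x)"
        by (simp add: fun_eq_iff image_image)
      moreover have "indicat_real ` K \<subseteq> \<phi>" "indicat_real ` K \<noteq> {}"
        using UN.IH False by auto
      ultimately show ?thesis
        using \<phi> by (simp add: fuzzy_topology_def)
    qed
  next
    case (Basis U)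
    then show ?case
      by (rule B)
  qed
qed

text \<open>At \<open>x\<close> the term of index \<open>c\<close> equals \<open>c\<close> if
  \<open>c < f x\<close> and 0 otherwise, so the terms approach \<open>f x\<close> from
  below.\<close>

lemma fuzzy_set_eq_SUP_min_indicator:
  assumes "f \<in> fuzzy_sets"
  shows "f x = (SUP c\<in>{0..1}. min c (indicat_real {y. c < f y} x))"
    (is "_ = (SUP c\<in>_. ?g c)")
proof (rule antisym)
  have f: "0 \<le> f x" "f x \<le> 1"
    using assms by (auto simp: fuzzy_sets_def)
  have bdd: "bdd_above (?g ` {0..1})"
    by (rule bdd_aboveI[of _ 1]) auto
  show "(SUP c\<in>{0..1}. ?g c) \<le> f x"
    using f by (intro cSUP_least) (auto simp: indicator_def)
  show "f x \<le> (SUP c\<in>{0..1}. ?g c)"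
  proof (rule ccontr)
    assume "\<not> ?thesis"
    then obtain c where c: "(SUP c\<in>{0..1}. ?g c) < c" "c < f x"
      using dense not_le by blast
    \<comment> \<open>The index 0 contributes the value 0. This makes the supremum nonnegative and
      so puts the intermediate \<open>c\<close> into the index set \<open>{0..1}\<close>.\<close>
    have "?g 0 \<le> (SUP c\<in>{0..1}. ?g c)"
      by (rule cSUP_upper[OF _ bdd]) simp
    then have "0 \<le> c"
      using c(1) by (simp add: indicator_def split: if_splits)
    then have "?g c \<le> (SUP c\<in>{0..1}. ?g c)"
      using c(2) f(2) by (intro cSUP_upper[OF _ bdd]) simp
    moreover have "?g c = c"
      using c(2) f(2) by simp
    ultimately show False
      using c(1) by simp
  qed
qed

lemma lsc_fuzzy_sets_subset_fuzzy_topology: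
  assumes \<phi>: "fuzzy_topology \<phi>" and T: "topspace T = UNIV"
    and ind: "\<And>U. openin T U \<Longrightarrow> indicat_real U \<in> \<phi>"
  shows "lsc_fuzzy_sets T \<subseteq> \<phi>"
proof
  fix f assume f: "f \<in> lsc_fuzzy_sets T"
  let ?g = "\<lambda>c x. min c (indicat_real {y. c < f y} x)"
  have "?g c \<in> \<phi>" if "c \<in> {0..1}" for c
  proof -
    have "openin T {y. c < f y}"
      using f T by (simp add: lsc_fuzzy_sets_def)
    then have "indicat_real {y. c < f y} \<in> \<phi>"
      by (rule ind)
    with \<phi> fuzzy_topology_const[OF \<phi> that] show ?thesis
      by (rule fuzzy_topology_min)
  qed
  then have "?g ` {0..1} \<subseteq> \<phi>"
    by (rule image_subsetI)
  with \<phi> have "(\<lambda>x. SUP h\<in>?g ` {0..1}. h x) \<in> \<phi>"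
    by (rule fuzzy_topology_SUP) simp
  \<comment> \<open>Closure under suprema speaks of sets of functions, hence the image;
    \<open>image_image\<close> returns to a supremum over \<open>c\<close>.\<close>
  moreover have "f = (\<lambda>x. SUP h\<in>?g ` {0..1}. h x)"
    unfolding image_image
  proof
    show "f x = (SUP c\<in>{0..1}. ?g c x)" for x
      using f by (intro fuzzy_set_eq_SUP_min_indicator[of f x]) (simp add: lsc_fuzzy_sets_def)
  qed
  ultimately show "f \<in> \<phi>"
    by simp
qed

text \<open>One inclusion is minimality of the generated fuzzy topology, since each functional is
  weakly continuous. For the other, indicators of subbasic sets yield those of all weakly open sets,
  and these yield all lower semicontinuous functions.\<close>

lemma weak_fuzzy_topology_lsc_fuzzy_sets:
  "weak_fuzzy_topology (lsc_fuzzy_sets euclidean) pairing = lsc_fuzzy_sets (weak_topology pairing)"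
    (is "?W = _")
proof (rule antisym)
  show "?W \<subseteq> lsc_fuzzy_sets (weak_topology pairing)"
  proof (rule weak_fuzzy_topology_coarsest)
    show "fuzzy_topology (lsc_fuzzy_sets (weak_topology pairing))"
      by (rule fuzzy_topology_lsc_fuzzy_sets)
    show "fuzzy_continuous (lsc_fuzzy_sets (weak_topology pairing)) (lsc_fuzzy_sets euclidean)
        (\<lambda>x. pairing x x')" for x'
      by (rule fuzzy_continuous_lsc_fuzzy_sets[OF continuous_map_weak_topology topspace_weak_topology])
  qed
  have W: "fuzzy_topology ?W"
    by (rule fuzzy_topology_weak_fuzzy_topology) (auto simp: lsc_fuzzy_sets_def)
  have basis: "indicat_real V \<in> ?W"
    if V: "V \<in> {(\<lambda>x. pairing x x') -` U | x' U. open U}" for V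
  proof -
    obtain x' U where U: "V = (\<lambda>x. pairing x x') -` U" "open U"
      using V by blast
    \<comment> \<open>The fuzzy topology on the scalars enters here through the indicators of open
      sets that it contains.\<close>
    have "indicat_real U \<in> lsc_fuzzy_sets euclidean"
      using U(2) by (simp add: indicator_in_lsc_fuzzy_sets)
    with fuzzy_continuous_weak_fuzzy_topology[of "lsc_fuzzy_sets euclidean" pairing x']
    have "indicat_real U \<circ> (\<lambda>x. pairing x x') \<in> ?W"
      unfolding fuzzy_continuous_def by (rule bspec)
    moreover have "indicat_real U \<circ> (\<lambda>x. pairing x x') = indicat_real V"
      by (auto simp: U(1) indicator_def)
    ultimately show ?thesis
      by simp
  qed
  show "lsc_fuzzy_sets (weak_topology pairing) \<subseteq> ?W"
  proof (rule lsc_fuzzy_sets_subset_fuzzy_topology[OF W topspace_weak_topology])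
    show "indicat_real U \<in> ?W" if "openin (weak_topology pairing) U" for U
      using W basis that unfolding weak_topology_def by (rule indicator_in_fuzzy_topology)
  qed
qed

theorem theorem3p17:
  fixes scaleE :: "real \<Rightarrow> 'a::ab_group_add \<Rightarrow> 'a"
    and scaleE' :: "real \<Rightarrow> 'b::ab_group_add \<Rightarrow> 'b"
    and pairing :: "'a \<Rightarrow> 'b \<Rightarrow> real"
    and cscaleE :: "complex \<Rightarrow> 'c::ab_group_add \<Rightarrow> 'c"
    and cscaleE' :: "complex \<Rightarrow> 'd::ab_group_add \<Rightarrow> 'd"
    and cpairing :: "'c \<Rightarrow> 'd \<Rightarrow> complex"
  shows "(dual_pair scaleE scaleE' pairing \<longrightarrow>
            weak_fuzzy_topology (lsc_fuzzy_sets euclidean) pairing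
              = lsc_fuzzy_sets (weak_topology pairing)) \<and>
         (dual_pair cscaleE cscaleE' cpairing \<longrightarrow>
            weak_fuzzy_topology (lsc_fuzzy_sets euclidean) cpairing
              = lsc_fuzzy_sets (weak_topology cpairing))"
  \<comment> \<open>Both conjuncts are instances of one equality, at real and at complex
    scalars.\<close>
  by (simp add: weak_fuzzy_topology_lsc_fuzzy_sets)

end
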